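(* Let $\mathbb{K}$ be a field of characteristic zero, let $D_n$ be the $n$-th Weyl algebra over $\mathbb{K}$, and let $g\in\mathbb{K}[x_1,\ldots,x_n]$. Consider the homomorphism of left $D_n$-modules $$\psi: D_n\to D_n/\langle\partial_1,\ldots,\partial_n\rangle,\qquad \psi(1)=g,$$ that is, $\psi(a)$ is the class of $ag$. Then $\operatorname{Ann}_{D_n}(g)=\ker\psi$.
   Context: $D_n=\mathbb{K}\langle x_1,\ldots,x_n,\partial_1,\ldots,\partial_n\mid \partial_ix_i=x_i\partial_i+1,\ \partial_ix_j=x_j\partial_i\ (i\ne j)\rangle$, where the $x_i$ commute with one another and the $\partial_i$ commute with one another. It acts on $\mathbb{K}[x_1,\ldots,x_n]$ by $x_i\bullet h=x_ih$ and $\partial_i\bullet h=\partial h/\partial x_i$. $\langle\partial_1,\ldots,\partial_n\rangle$ is the left ideal generated by $\partial_1,\ldots,\partial_n$, and $\operatorname{Ann}_{D_n}(g)=\{a\in D_n\mid a\bullet g=0\}$. *)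

theory Defs
  imports "HOL-Library.Poly_Mapping"
begin

text \<open>
  The variables are indexed by a type \<open>'n\<close>; for \<open>n\<close> variables it is a finite type with
  \<open>CARD('n) = n\<close>.  A monomial is its exponent vector of type
  \<open>'n \<Rightarrow>\<^sub>0 nat\<close>; the multiplication of \<open>poly_mapping\<close> is the convolution product.
\<close>

type_synonym ('n, 'k) mpoly = "('n \<Rightarrow>\<^sub>0 nat) \<Rightarrow>\<^sub>0 'k"

abbreviation mpoly_const :: "'k::zero \<Rightarrow> ('n, 'k) mpoly" where
  "mpoly_const c \<equiv> Poly_Mapping.single 0 c"

abbreviation mpoly_var :: "'n \<Rightarrow> ('n, 'k::zero_neq_one) mpoly" where
  "mpoly_var i \<equiv> Poly_Mapping.single (Poly_Mapping.single i 1) 1"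

text \<open>The formal partial derivative, given by its coefficients; see \<open>pderivative_single\<close>.\<close>

lift_definition pderivative :: "'n \<Rightarrow> ('n, 'k::comm_ring_1) mpoly \<Rightarrow> ('n, 'k) mpoly" is
  "\<lambda>i p \<alpha>. of_nat (Suc (Poly_Mapping.lookup \<alpha> i)) * p (\<alpha> + Poly_Mapping.single i 1)"
proof -
  fix i :: 'n and p :: "('n \<Rightarrow>\<^sub>0 nat) \<Rightarrow> 'k"
  assume fin: "finite {\<alpha>. p \<alpha> \<noteq> 0}"
  have "inj (\<lambda>\<alpha> :: 'n \<Rightarrow>\<^sub>0 nat. \<alpha> + Poly_Mapping.single i 1)"
    by (rule injI) simp
  then have "finite ((\<lambda>\<alpha> :: 'n \<Rightarrow>\<^sub>0 nat. \<alpha> + Poly_Mapping.single i 1) -` {\<alpha>. p \<alpha> \<noteq> 0})"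
    by (rule finite_vimageI[OF fin])
  then show "finite {\<alpha>. of_nat (Suc (Poly_Mapping.lookup \<alpha> i))
      * p (\<alpha> + Poly_Mapping.single i 1) \<noteq> 0}"
    by (rule rev_finite_subset) auto
qed

lemma pderivative_add: "pderivative i (p + q) = pderivative i p + pderivative i q"
  by (rule poly_mapping_eqI) (simp add: pderivative.rep_eq lookup_add algebra_simps)

lemma pderivative_zero [simp]: "pderivative i 0 = 0"
  by (rule poly_mapping_eqI) (simp add: pderivative.rep_eq)

lemma pderivative_single:
  "pderivative i (Poly_Mapping.single \<alpha> c) =
     Poly_Mapping.single (\<alpha> - Poly_Mapping.single i 1) (of_nat (Poly_Mapping.lookup \<alpha> i) * c)"
proof (rule poly_mapping_eqI)
  fix \<beta> :: "'a \<Rightarrow>\<^sub>0 nat"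
  have *: "\<beta> + Poly_Mapping.single i 1 = \<alpha> \<longleftrightarrow>
      Poly_Mapping.lookup \<alpha> i \<noteq> 0 \<and> \<alpha> - Poly_Mapping.single i 1 = \<beta>"
  proof
    assume "\<beta> + Poly_Mapping.single i 1 = \<alpha>"
    then show "Poly_Mapping.lookup \<alpha> i \<noteq> 0 \<and> \<alpha> - Poly_Mapping.single i 1 = \<beta>"
      by (auto simp: lookup_add)
  next
    assume a: "Poly_Mapping.lookup \<alpha> i \<noteq> 0 \<and> \<alpha> - Poly_Mapping.single i 1 = \<beta>"
    show "\<beta> + Poly_Mapping.single i 1 = \<alpha>"
    proof (rule poly_mapping_eqI)
      fix j
      show "Poly_Mapping.lookup (\<beta> + Poly_Mapping.single i 1) j = Poly_Mapping.lookup \<alpha> j"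
        using a by (auto simp: lookup_add lookup_minus lookup_single when_def)
    qed
  qed
  have **: "Suc (Poly_Mapping.lookup \<beta> i) = Poly_Mapping.lookup \<alpha> i"
    if "\<beta> + Poly_Mapping.single i 1 = \<alpha>"
    using that by (auto simp: lookup_add)
  show "Poly_Mapping.lookup (pderivative i (Poly_Mapping.single \<alpha> c)) \<beta> =
    Poly_Mapping.lookup (Poly_Mapping.single (\<alpha> - Poly_Mapping.single i 1)
      (of_nat (Poly_Mapping.lookup \<alpha> i) * c)) \<beta>"
  proof (cases "\<beta> + Poly_Mapping.single i 1 = \<alpha>")
    case True
    then show ?thesis using ** [OF True] *
      by (simp add: pderivative.rep_eq lookup_single del: of_nat_Suc)
  next
    case False
    then have "Poly_Mapping.lookup \<alpha> i = 0 \<or> \<alpha> - Poly_Mapping.single i 1 \<noteq> \<beta>"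
      using * by blast
    then show ?thesis using False
      by (auto simp: pderivative.rep_eq lookup_single when_def)
  qed
qed

lemma poly_mapping_sum_single:
  "(\<Sum>k\<in>Poly_Mapping.keys p. Poly_Mapping.single k (Poly_Mapping.lookup p k)) = p"
proof (rule poly_mapping_eqI)
  fix k
  show "Poly_Mapping.lookup (\<Sum>k\<in>Poly_Mapping.keys p.
      Poly_Mapping.single k (Poly_Mapping.lookup p k)) k = Poly_Mapping.lookup p k"
    by (auto simp: lookup_sum lookup_single when_def sum.delta in_keys_iff)
qed

lemma poly_mapping_single_induct [case_names zero add single]:
  fixes p :: "'a \<Rightarrow>\<^sub>0 'b::comm_monoid_add"
  assumes "P 0" and "\<And>p q. P p \<Longrightarrow> P q \<Longrightarrow> P (p + q)"
    and "\<And>k c. P (Poly_Mapping.single k c)"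
  shows "P p"
proof -
  have "P (\<Sum>k\<in>A. Poly_Mapping.single k (Poly_Mapping.lookup p k))" if "finite A" for A
    using that by (induction A) (auto intro: assms)
  from this [OF finite_keys [of p]] show ?thesis
    by (simp add: poly_mapping_sum_single)
qed

lemma pderivative_scale: "pderivative i (mpoly_const c * p) = mpoly_const c * pderivative i p"
  by (induction p rule: poly_mapping_single_induct)
    (simp_all add: distrib_left pderivative_add pderivative_single mult_single algebra_simps)

lemma pderivative_commute: "pderivative i (pderivative j p) = pderivative j (pderivative i p)"
proof (cases "i = j")
  case False
  then show ?thesis
    by (intro poly_mapping_eqI)
      (simp add: pderivative.rep_eq lookup_add lookup_single add.assoc
        add.commute [of "Poly_Mapping.single i (Suc 0)"] mult.left_commute)
qed simp

lemma pderivative_var_mult_same: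
  "pderivative i (mpoly_var i * p) = mpoly_var i * pderivative i p + p"
proof (induction p rule: poly_mapping_single_induct)
  case (single \<alpha> c)
  have *: "Poly_Mapping.single i 1 + (\<alpha> - Poly_Mapping.single i 1) = \<alpha>"
    if "Poly_Mapping.lookup \<alpha> i \<noteq> 0"
    using that by (intro poly_mapping_eqI)
      (auto simp: lookup_add lookup_minus lookup_single when_def)
  show ?case
  proof (cases "Poly_Mapping.lookup \<alpha> i = 0")
    case False
    then show ?thesis using *
      by (simp add: pderivative_single mult_single lookup_add single_add [symmetric] algebra_simps)
  qed (simp add: pderivative_single mult_single lookup_add)
qed (simp_all add: distrib_left pderivative_add)

lemma pderivative_var_mult_other:
  assumes "i \<noteq> j"
  shows "pderivative i (mpoly_var j * p) = mpoly_var j * pderivative i p"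
proof (induction p rule: poly_mapping_single_induct)
  case (single \<alpha> c)
  have *: "Poly_Mapping.single j 1 + \<alpha> - Poly_Mapping.single i 1
      = Poly_Mapping.single j 1 + (\<alpha> - Poly_Mapping.single i 1)"
    using assms by (intro poly_mapping_eqI)
      (auto simp: lookup_add lookup_minus lookup_single when_def)
  show ?case using assms *
    by (simp add: pderivative_single mult_single lookup_add lookup_single)
qed (simp_all add: distrib_left pderivative_add)


datatype 'n weyl_gen = Gen_X 'n | Gen_D 'n

text \<open>
  Words, i.e.\ the free monoid.  Written additively because the product of \<open>poly_mapping\<close> is
  convolution over an additive monoid of exponents; this addition is not commutative.
\<close>

datatype 'n word = Word (letters: "'n weyl_gen list")

instantiation word :: (type) monoid_add
begin

definition zero_word :: "'a word" where "0 = Word []"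

definition plus_word :: "'a word \<Rightarrow> 'a word \<Rightarrow> 'a word" where
  "v + w = Word (letters v @ letters w)"

instance
  by standard (simp_all add: zero_word_def plus_word_def)

end

type_synonym ('n, 'k) free_algebra = "'n word \<Rightarrow>\<^sub>0 'k"

abbreviation free_x :: "'n \<Rightarrow> ('n, 'k::zero_neq_one) free_algebra" where
  "free_x i \<equiv> Poly_Mapping.single (Word [Gen_X i]) 1"

abbreviation free_d :: "'n \<Rightarrow> ('n, 'k::zero_neq_one) free_algebra" where
  "free_d i \<equiv> Poly_Mapping.single (Word [Gen_D i]) 1"


lemma diff_add_rearrange: "(a + c) - (b + d) = (a - b) + (c - d)" for a :: "'a::ab_group_add"
  by (simp add: algebra_simps)

lemma diff_diff_rearrange: "(a - c) - (b - d) = (a - b) - (c - d)" for a :: "'a::ab_group_add"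
  by (simp add: algebra_simps)

text \<open>
  Generated ideals, as the sets of finite sums of multiples of generators.  They are closed under
  negation because the multipliers range over the whole ring.
\<close>

inductive_set two_sided_ideal :: "'a::ring_1 set \<Rightarrow> 'a set" for S where
  zero: "0 \<in> two_sided_ideal S"
| generator: "s \<in> S \<Longrightarrow> a * s * b \<in> two_sided_ideal S"
| add: "p \<in> two_sided_ideal S \<Longrightarrow> q \<in> two_sided_ideal S \<Longrightarrow> p + q \<in> two_sided_ideal S"

inductive_set left_ideal :: "'a::ring_1 set \<Rightarrow> 'a set" for S where
  zero: "0 \<in> left_ideal S"
| generator: "s \<in> S \<Longrightarrow> a * s \<in> left_ideal S"
| add: "p \<in> left_ideal S \<Longrightarrow> q \<in> left_ideal S \<Longrightarrow> p + q \<in> left_ideal S"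

lemma two_sided_ideal_mult_left:
  "p \<in> two_sided_ideal S \<Longrightarrow> a * p \<in> two_sided_ideal S"
proof (induction rule: two_sided_ideal.induct)
  case (generator s c b)
  then show ?case using two_sided_ideal.generator [of s S "a * c" b] by (simp add: mult.assoc)
qed (auto simp: distrib_left intro: two_sided_ideal.intros)

lemma two_sided_ideal_mult_right:
  "p \<in> two_sided_ideal S \<Longrightarrow> p * a \<in> two_sided_ideal S"
proof (induction rule: two_sided_ideal.induct)
  case (generator s c b)
  then show ?case using two_sided_ideal.generator [of s S c "b * a"] by (simp add: mult.assoc)
qed (auto simp: distrib_right intro: two_sided_ideal.intros)

lemma two_sided_ideal_uminus: "p \<in> two_sided_ideal S \<Longrightarrow> - p \<in> two_sided_ideal S"
  using two_sided_ideal_mult_left [of p S "- 1"] by simp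

lemma two_sided_ideal_diff:
  "p \<in> two_sided_ideal S \<Longrightarrow> q \<in> two_sided_ideal S \<Longrightarrow> p - q \<in> two_sided_ideal S"
  using two_sided_ideal.add [of p S "- q"] two_sided_ideal_uminus [of q S] by simp

lemma left_ideal_mult_left: "p \<in> left_ideal S \<Longrightarrow> a * p \<in> left_ideal S"
proof (induction rule: left_ideal.induct)
  case (generator s c)
  then show ?case using left_ideal.generator [of s S "a * c"] by (simp add: mult.assoc)
qed (auto simp: distrib_left intro: left_ideal.intros)

lemma left_ideal_uminus: "p \<in> left_ideal S \<Longrightarrow> - p \<in> left_ideal S"
  using left_ideal_mult_left [of p S "- 1"] by simp

lemma left_ideal_diff: "p \<in> left_ideal S \<Longrightarrow> q \<in> left_ideal S \<Longrightarrow> p - q \<in> left_ideal S"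
  using left_ideal.add [of p S "- q"] left_ideal_uminus [of q S] by simp


definition weyl_relations :: "('n, 'k::field) free_algebra set" where
  "weyl_relations =
     {free_d i * free_x i - (free_x i * free_d i + 1) | i. True}
   \<union> {free_d i * free_x j - free_x j * free_d i | i j. i \<noteq> j}
   \<union> {free_x i * free_x j - free_x j * free_x i | i j. True}
   \<union> {free_d i * free_d j - free_d j * free_d i | i j. True}"

definition weyl_eq :: "('n, 'k::field) free_algebra \<Rightarrow> ('n, 'k) free_algebra \<Rightarrow> bool" where
  "weyl_eq p q \<longleftrightarrow> p - q \<in> two_sided_ideal weyl_relations"

lemma equivp_weyl_eq: "equivp (weyl_eq :: ('a, 'b::field) free_algebra \<Rightarrow> _)"
proof (rule equivpI)
  show "reflp (weyl_eq :: ('a, 'b) free_algebra \<Rightarrow> _)"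
    by (auto simp: reflp_def weyl_eq_def intro: two_sided_ideal.zero)
  show "symp (weyl_eq :: ('a, 'b) free_algebra \<Rightarrow> _)"
    unfolding symp_def weyl_eq_def using two_sided_ideal_uminus by fastforce
  show "transp (weyl_eq :: ('a, 'b) free_algebra \<Rightarrow> _)"
  proof (rule transpI)
    fix p q r :: "('a, 'b) free_algebra"
    assume "weyl_eq p q" "weyl_eq q r"
    then show "weyl_eq p r"
      using two_sided_ideal.add [of "p - q" weyl_relations "q - r"] by (simp add: weyl_eq_def)
  qed
qed

quotient_type (overloaded) ('n, 'k) weyl = "('n, 'k::field) free_algebra" / weyl_eq
  by (rule equivp_weyl_eq)

text \<open>
  The action on polynomials is defined on the free algebra first: a word acts by applying its
  letters successively, the last one first.
\<close>

primrec gen_act :: "'n weyl_gen \<Rightarrow> ('n, 'k::field) mpoly \<Rightarrow> ('n, 'k) mpoly" where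
  "gen_act (Gen_X i) h = mpoly_var i * h"
| "gen_act (Gen_D i) h = pderivative i h"

definition word_act :: "'n word \<Rightarrow> ('n, 'k::field) mpoly \<Rightarrow> ('n, 'k) mpoly" where
  "word_act w h = List.foldr gen_act (letters w) h"

definition free_act :: "('n, 'k::field) free_algebra \<Rightarrow> ('n, 'k) mpoly \<Rightarrow> ('n, 'k) mpoly" where
  "free_act p h = (\<Sum>w\<in>Poly_Mapping.keys p. mpoly_const (Poly_Mapping.lookup p w) * word_act w h)"

lemma gen_act_add: "gen_act l (h + h') = gen_act l h + gen_act l h'"
  by (cases l) (simp_all add: distrib_left pderivative_add)

lemma gen_act_scale: "gen_act l (mpoly_const c * h) = mpoly_const c * gen_act l h"
  by (cases l) (simp_all add: pderivative_scale mult.left_commute)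

lemma word_act_add: "word_act w (h + h') = word_act w h + word_act w h'"
proof -
  have "List.foldr gen_act ls (h + h') = List.foldr gen_act ls h + List.foldr gen_act ls h'" for ls
    by (induction ls) (simp_all add: gen_act_add)
  then show ?thesis by (simp add: word_act_def)
qed

lemma word_act_scale: "word_act w (mpoly_const c * h) = mpoly_const c * word_act w h"
proof -
  have "List.foldr gen_act ls (mpoly_const c * h) = mpoly_const c * List.foldr gen_act ls h" for ls
    by (induction ls) (simp_all add: gen_act_scale)
  then show ?thesis by (simp add: word_act_def)
qed

lemma word_act_0 [simp]: "word_act w 0 = 0"
  using word_act_scale [of w 0 0] by simp

lemma word_act_plus: "word_act (v + w) h = word_act v (word_act w h)"
  by (simp add: word_act_def plus_word_def)

lemma free_act_superset:
  assumes "finite A" "Poly_Mapping.keys p \<subseteq> A"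
  shows "free_act p h = (\<Sum>w\<in>A. mpoly_const (Poly_Mapping.lookup p w) * word_act w h)"
  unfolding free_act_def using assms
  by (intro sum.mono_neutral_left) (auto simp: in_keys_iff)

lemma free_act_single [simp]:
  "free_act (Poly_Mapping.single w c) h = mpoly_const c * word_act w h"
  by (subst free_act_superset [of "{w}"]) auto

lemma free_act_zero_left [simp]: "free_act 0 h = 0"
  by (simp add: free_act_def)

lemma free_act_add_left: "free_act (p + q) h = free_act p h + free_act q h"
proof -
  define A where "A = Poly_Mapping.keys p \<union> Poly_Mapping.keys q"
  have "finite A" "Poly_Mapping.keys p \<subseteq> A" "Poly_Mapping.keys q \<subseteq> A"
    "Poly_Mapping.keys (p + q) \<subseteq> A"
    using keys_add [of p q] by (auto simp: A_def)
  then show ?thesis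
    by (simp add: free_act_superset [of A] lookup_add single_add distrib_right sum.distrib)
qed

lemma free_act_add_right: "free_act p (h + h') = free_act p h + free_act p h'"
  by (simp add: free_act_def word_act_add distrib_left sum.distrib)

lemma free_act_zero_right [simp]: "free_act p 0 = 0"
  by (simp add: free_act_def)

lemma free_act_diff_left: "free_act (p - q) h = free_act p h - free_act q h"
  using free_act_add_left [of "p - q" q h] by simp

lemma free_act_one [simp]: "free_act 1 h = h"
proof -
  have "free_act (Poly_Mapping.single 0 1) h = h"
    by (simp only: free_act_single) (simp add: word_act_def zero_word_def)
  then show ?thesis by simp
qed

lemma free_act_mult: "free_act (p * q) h = free_act p (free_act q h)"
proof (induction p rule: poly_mapping_single_induct)
  case (single v a)
  show ?case
  proof (induction q rule: poly_mapping_single_induct)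
    case (single w b)
    show ?case
      by (simp add: mult_single word_act_plus word_act_scale mult.assoc [symmetric])
  qed (simp_all add: distrib_left free_act_add_left free_act_add_right)
qed (simp_all add: distrib_right free_act_add_left)

lemma free_act_free_x: "free_act (free_x i) h = mpoly_var i * h"
  by (simp add: word_act_def)

lemma free_act_free_d: "free_act (free_d i) h = pderivative i h"
  by (simp add: word_act_def)

lemma free_act_relation:
  assumes "r \<in> weyl_relations"
  shows "free_act r h = 0"
  using assms unfolding weyl_relations_def
  by (auto simp: free_act_diff_left free_act_add_left free_act_mult free_act_free_x
      free_act_free_d mult.left_commute pderivative_commute
      pderivative_var_mult_same [unfolded One_nat_def]
      pderivative_var_mult_other [unfolded One_nat_def] simp del: free_act_single)

lemma free_act_ideal: "p \<in> two_sided_ideal weyl_relations \<Longrightarrow> free_act p h = 0"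
  by (induction arbitrary: h rule: two_sided_ideal.induct)
    (simp_all add: free_act_mult free_act_relation free_act_add_left)

instantiation weyl :: (type, field) ring_1
begin

lift_definition zero_weyl :: "('a, 'b) weyl" is 0 .

lift_definition one_weyl :: "('a, 'b) weyl" is 1 .

lift_definition plus_weyl :: "('a, 'b) weyl \<Rightarrow> ('a, 'b) weyl \<Rightarrow> ('a, 'b) weyl" is "(+)"
  unfolding weyl_eq_def by (subst diff_add_rearrange) (rule two_sided_ideal.add)

lift_definition minus_weyl :: "('a, 'b) weyl \<Rightarrow> ('a, 'b) weyl \<Rightarrow> ('a, 'b) weyl" is "(-)"
  unfolding weyl_eq_def by (subst diff_diff_rearrange) (rule two_sided_ideal_diff)

lift_definition uminus_weyl :: "('a, 'b) weyl \<Rightarrow> ('a, 'b) weyl" is uminus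
  unfolding weyl_eq_def using two_sided_ideal_uminus by fastforce

lift_definition times_weyl :: "('a, 'b) weyl \<Rightarrow> ('a, 'b) weyl \<Rightarrow> ('a, 'b) weyl" is "(*)"
proof -
  fix p p' q q' :: "('a, 'b) free_algebra"
  assume "weyl_eq p p'" "weyl_eq q q'"
  then have "(p - p') * q + p' * (q - q') \<in> two_sided_ideal weyl_relations"
    unfolding weyl_eq_def
    by (intro two_sided_ideal.add two_sided_ideal_mult_left two_sided_ideal_mult_right)
  then show "weyl_eq (p * q) (p' * q')"
    by (simp add: weyl_eq_def algebra_simps)
qed

instance
proof
  show "(0 :: ('a, 'b) weyl) \<noteq> 1"
  proof (transfer, rule notI)
    assume "weyl_eq (0 :: ('a, 'b) free_algebra) 1"
    then have "free_act (0 - 1 :: ('a, 'b) free_algebra) 1 = 0"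
      unfolding weyl_eq_def by (rule free_act_ideal)
    then show False by (simp only: free_act_diff_left) simp
  qed
qed (transfer; simp add: algebra_simps weyl_eq_def two_sided_ideal.zero)+

end

lift_definition weyl_act :: "('n, 'k::field) weyl \<Rightarrow> ('n, 'k) mpoly \<Rightarrow> ('n, 'k) mpoly"
    (infixr \<open>\<bullet>\<close> 75) is free_act
proof
  fix p q :: "('n, 'k) free_algebra" and h
  assume "weyl_eq p q"
  then have "free_act (p - q) h = 0"
    unfolding weyl_eq_def by (rule free_act_ideal)
  then show "free_act p h = free_act q h"
    by (simp add: free_act_diff_left)
qed

lift_definition weyl_const :: "'k::field \<Rightarrow> ('n, 'k) weyl" is "Poly_Mapping.single 0" .

lift_definition weyl_x :: "'n \<Rightarrow> ('n, 'k::field) weyl" is free_x .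

lift_definition weyl_d :: "'n \<Rightarrow> ('n, 'k::field) weyl" is free_d .

lemma weyl_relation_zero: "r \<in> weyl_relations \<Longrightarrow> r \<in> two_sided_ideal weyl_relations"
  using two_sided_ideal.generator [of r weyl_relations 1 1] by simp

lemma weyl_d_x_same: "weyl_d i * weyl_x i = weyl_x i * weyl_d i + 1"
  by transfer (unfold weyl_eq_def, rule weyl_relation_zero, unfold weyl_relations_def, blast)

lemma weyl_d_x_other: "i \<noteq> j \<Longrightarrow> weyl_d i * weyl_x j = weyl_x j * weyl_d i"
  by transfer (unfold weyl_eq_def, rule weyl_relation_zero, unfold weyl_relations_def, blast)

lemma weyl_x_commute: "weyl_x i * weyl_x j = weyl_x j * weyl_x i"
  by transfer (unfold weyl_eq_def, rule weyl_relation_zero, unfold weyl_relations_def, blast)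

lemma weyl_d_commute: "weyl_d i * weyl_d j = weyl_d j * weyl_d i"
  by transfer (unfold weyl_eq_def, rule weyl_relation_zero, unfold weyl_relations_def, blast)

lemma weyl_const_commute: "weyl_const c * a = a * weyl_const c"
proof transfer
  fix c :: 'b and p :: "('a, 'b) free_algebra"
  have "Poly_Mapping.single 0 c * p = p * Poly_Mapping.single 0 c"
    by (induction p rule: poly_mapping_single_induct)
      (simp_all add: distrib_left distrib_right mult_single mult.commute)
  then show "weyl_eq (Poly_Mapping.single 0 c * p) (p * Poly_Mapping.single 0 c)"
    by (simp add: weyl_eq_def two_sided_ideal.zero)
qed

lemma weyl_const_add: "weyl_const (c + d) = weyl_const c + weyl_const d"
  by transfer (simp add: single_add weyl_eq_def two_sided_ideal.zero)

lemma weyl_const_mult: "weyl_const (c * d) = weyl_const c * weyl_const d"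
  by transfer (simp add: mult_single weyl_eq_def two_sided_ideal.zero)

lemma weyl_const_0 [simp]: "weyl_const 0 = 0"
  by transfer (simp add: weyl_eq_def two_sided_ideal.zero)

lemma weyl_const_1 [simp]: "weyl_const 1 = 1"
  by transfer (simp add: weyl_eq_def two_sided_ideal.zero)

lemma weyl_act_one: "1 \<bullet> h = h"
  by transfer simp

lemma weyl_act_mult: "(a * b) \<bullet> h = a \<bullet> b \<bullet> h"
  by transfer (rule free_act_mult)

lemma weyl_act_add_left: "(a + b) \<bullet> h = a \<bullet> h + b \<bullet> h"
  by transfer (rule free_act_add_left)

lemma weyl_act_add_right: "a \<bullet> (h + h') = a \<bullet> h + a \<bullet> h'"
  by transfer (rule free_act_add_right)

lemma weyl_act_const: "weyl_const c \<bullet> h = mpoly_const c * h"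
  by transfer (simp add: word_act_def zero_word_def)

lemma weyl_act_x: "weyl_x i \<bullet> h = mpoly_var i * h"
  by transfer (rule free_act_free_x)

lemma weyl_act_d: "weyl_d i \<bullet> h = pderivative i h"
  by transfer (rule free_act_free_d)

definition weyl_Ann :: "('n, 'k::field) mpoly \<Rightarrow> ('n, 'k) weyl set" where
  "weyl_Ann g = {a. a \<bullet> g = 0}"


text \<open>
  The product over the variables of a monomial is a fold since \<open>weyl\<close> is not commutative; it does
  not depend on the order of the factors, because the \<open>x\<^sub>i\<close> commute (\<open>weyl_x_fun_commute\<close>).
\<close>

definition weyl_monom :: "('n \<Rightarrow>\<^sub>0 nat) \<Rightarrow> ('n, 'k::field) weyl" where
  "weyl_monom \<alpha> = Finite_Set.fold (\<lambda>i m. weyl_x i ^ Poly_Mapping.lookup \<alpha> i * m) 1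
     (Poly_Mapping.keys \<alpha>)"

definition weyl_of_poly :: "('n, 'k::field) mpoly \<Rightarrow> ('n, 'k) weyl" where
  "weyl_of_poly g =
     (\<Sum>\<alpha>\<in>Poly_Mapping.keys g. weyl_const (Poly_Mapping.lookup g \<alpha>) * weyl_monom \<alpha>)"

lemma power_commute_noncomm:
  fixes a b :: "'a::monoid_mult"
  assumes "a * b = b * a"
  shows "a ^ m * b ^ n = b ^ n * a ^ m"
  using assms by (metis power_commuting_commutes)

lemma weyl_x_fun_commute:
  "comp_fun_commute (\<lambda>i m. weyl_x i ^ Poly_Mapping.lookup \<alpha> i * m)"
  by standard
    (auto simp: fun_eq_iff mult.assoc [symmetric] power_commute_noncomm [OF weyl_x_commute])

abbreviation (input) weyl_monom_on :: "'n set \<Rightarrow> ('n \<Rightarrow>\<^sub>0 nat) \<Rightarrow> ('n, 'k::field) weyl" where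
  "weyl_monom_on F \<alpha> \<equiv> Finite_Set.fold (\<lambda>i m. weyl_x i ^ Poly_Mapping.lookup \<alpha> i * m) 1 F"

lemma weyl_monom_on_insert:
  "finite F \<Longrightarrow> i \<notin> F \<Longrightarrow>
     weyl_monom_on (insert i F) \<alpha> = weyl_x i ^ Poly_Mapping.lookup \<alpha> i * weyl_monom_on F \<alpha>"
  by (rule comp_fun_commute_on.fold_insert
      [OF weyl_x_fun_commute [unfolded comp_fun_commute_def']]) auto

lemma weyl_monom_on_keys:
  assumes "finite F" "Poly_Mapping.keys \<alpha> \<subseteq> F"
  shows "(weyl_monom \<alpha> :: ('a, 'b::field) weyl) = weyl_monom_on F \<alpha>"
proof -
  have "weyl_monom_on (Poly_Mapping.keys \<alpha> \<union> G) \<alpha> = (weyl_monom \<alpha> :: ('a, 'b) weyl)"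
    if "finite G" "G \<inter> Poly_Mapping.keys \<alpha> = {}" for G
    using that
  proof (induction G)
    case (insert i G)
    then show ?case
      by (simp add: weyl_monom_on_insert in_keys_iff)
  qed (simp add: weyl_monom_def)
  note * = this
  have "weyl_monom_on (Poly_Mapping.keys \<alpha> \<union> (F - Poly_Mapping.keys \<alpha>)) \<alpha> =
      (weyl_monom \<alpha> :: ('a, 'b) weyl)"
    by (rule *) (use assms in auto)
  moreover have "Poly_Mapping.keys \<alpha> \<union> (F - Poly_Mapping.keys \<alpha>) = F"
    using assms by blast
  ultimately show ?thesis by simp
qed

lemma weyl_monom_on_commute_x:
  "finite F \<Longrightarrow> weyl_x i ^ k * weyl_monom_on F \<alpha> = weyl_monom_on F \<alpha> * (weyl_x i ^ k :: ('a, 'b::field) weyl)"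
proof (induction F rule: finite_induct)
  case (insert j F)
  have "weyl_x i ^ k * (weyl_x j ^ Poly_Mapping.lookup \<alpha> j * weyl_monom_on F \<alpha>)
      = weyl_x j ^ Poly_Mapping.lookup \<alpha> j * ((weyl_x i ^ k :: ('a, 'b) weyl) * weyl_monom_on F \<alpha>)"
    by (simp add: mult.assoc [symmetric] power_commute_noncomm [OF weyl_x_commute [of i j]])
  then show ?case
    using insert by (simp add: weyl_monom_on_insert mult.assoc)
qed simp

lemma weyl_monom_on_add:
  "finite F \<Longrightarrow> (weyl_monom_on F (\<alpha> + \<beta>) :: ('a, 'b::field) weyl) = weyl_monom_on F \<alpha> * weyl_monom_on F \<beta>"
proof (induction F rule: finite_induct)
  case (insert j F)
  have "(weyl_x j ^ Poly_Mapping.lookup \<alpha> j :: ('a, 'b) weyl) * weyl_monom_on F \<alpha> *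
      (weyl_x j ^ Poly_Mapping.lookup \<beta> j * weyl_monom_on F \<beta>)
    = weyl_x j ^ Poly_Mapping.lookup \<alpha> j *
      (weyl_monom_on F \<alpha> * weyl_x j ^ Poly_Mapping.lookup \<beta> j) * weyl_monom_on F \<beta>"
    by (simp add: mult.assoc)
  also have "\<dots> = weyl_x j ^ Poly_Mapping.lookup (\<alpha> + \<beta>) j *
      (weyl_monom_on F \<alpha> * weyl_monom_on F \<beta>)"
    by (simp add: weyl_monom_on_commute_x [OF insert.hyps(1), symmetric] lookup_add power_add
        mult.assoc)
  finally show ?case
    using insert by (simp add: weyl_monom_on_insert)
qed simp

lemma weyl_monom_0 [simp]: "weyl_monom 0 = 1"
  by (simp add: weyl_monom_def)

lemma weyl_monom_var: "weyl_monom (Poly_Mapping.single i 1) = weyl_x i"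
  using weyl_monom_on_insert [of "{}" i "Poly_Mapping.single i 1"]
  by (simp add: weyl_monom_def)

lemma weyl_monom_add: "weyl_monom (\<alpha> + \<beta>) = weyl_monom \<alpha> * weyl_monom \<beta>"
proof -
  define F where "F = Poly_Mapping.keys \<alpha> \<union> Poly_Mapping.keys \<beta>"
  have "finite F" "Poly_Mapping.keys \<alpha> \<subseteq> F" "Poly_Mapping.keys \<beta> \<subseteq> F"
    "Poly_Mapping.keys (\<alpha> + \<beta>) \<subseteq> F"
    using keys_add [of \<alpha> \<beta>] by (auto simp: F_def)
  then show ?thesis
    by (simp add: weyl_monom_on_keys [of F] weyl_monom_on_add)
qed

lemma weyl_of_poly_superset:
  assumes "finite A" "Poly_Mapping.keys g \<subseteq> A"
  shows "weyl_of_poly g = (\<Sum>\<alpha>\<in>A. weyl_const (Poly_Mapping.lookup g \<alpha>) * weyl_monom \<alpha>)"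
  unfolding weyl_of_poly_def using assms
  by (intro sum.mono_neutral_left) (auto simp: in_keys_iff)

lemma weyl_of_poly_single: "weyl_of_poly (Poly_Mapping.single \<alpha> c) = weyl_const c * weyl_monom \<alpha>"
  by (subst weyl_of_poly_superset [of "{\<alpha>}"]) auto

lemma weyl_of_poly_const: "weyl_of_poly (mpoly_const c) = weyl_const c"
  by (simp add: weyl_of_poly_single)

lemma weyl_of_poly_var: "weyl_of_poly (mpoly_var i) = weyl_x i"
  using weyl_monom_var by (simp add: weyl_of_poly_single)

lemma weyl_of_poly_0 [simp]: "weyl_of_poly 0 = 0"
  by (simp add: weyl_of_poly_def)

lemma weyl_of_poly_add: "weyl_of_poly (g + h) = weyl_of_poly g + weyl_of_poly h"
proof -
  define A where "A = Poly_Mapping.keys g \<union> Poly_Mapping.keys h"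
  have "finite A" "Poly_Mapping.keys g \<subseteq> A" "Poly_Mapping.keys h \<subseteq> A"
    "Poly_Mapping.keys (g + h) \<subseteq> A"
    using keys_add [of g h] by (auto simp: A_def)
  then show ?thesis
    by (simp add: weyl_of_poly_superset [of A] lookup_add weyl_const_add distrib_right
        sum.distrib)
qed

lemma weyl_of_poly_mult: "weyl_of_poly (g * h) = weyl_of_poly g * weyl_of_poly h"
proof (induction g rule: poly_mapping_single_induct)
  case (single \<alpha> c)
  show ?case
  proof (induction h rule: poly_mapping_single_induct)
    case (single \<beta> d)
    have "weyl_const c * weyl_const d * (weyl_monom \<alpha> * weyl_monom \<beta>)
        = weyl_const c * (weyl_const d * weyl_monom \<alpha>) * weyl_monom \<beta>"
      by (simp add: mult.assoc)
    also have "\<dots> = weyl_const c * weyl_monom \<alpha> * (weyl_const d * weyl_monom \<beta>)"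
      by (simp add: weyl_const_commute [of d "weyl_monom \<alpha>"] mult.assoc)
    finally show ?case
      by (simp add: mult_single weyl_of_poly_single weyl_monom_add weyl_const_mult)
  qed (simp_all add: distrib_left weyl_of_poly_add)
qed (simp_all add: distrib_right weyl_of_poly_add)


definition weyl_mod_eq :: "('n, 'k::field) weyl \<Rightarrow> ('n, 'k) weyl \<Rightarrow> bool" where
  "weyl_mod_eq a b \<longleftrightarrow> a - b \<in> left_ideal (range weyl_d)"

lemma equivp_weyl_mod_eq: "equivp (weyl_mod_eq :: ('a, 'b::field) weyl \<Rightarrow> _)"
proof (rule equivpI)
  show "reflp (weyl_mod_eq :: ('a, 'b) weyl \<Rightarrow> _)"
    by (auto simp: reflp_def weyl_mod_eq_def intro: left_ideal.zero)
  show "symp (weyl_mod_eq :: ('a, 'b) weyl \<Rightarrow> _)"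
    unfolding symp_def weyl_mod_eq_def using left_ideal_uminus by fastforce
  show "transp (weyl_mod_eq :: ('a, 'b) weyl \<Rightarrow> _)"
  proof (rule transpI)
    fix a b c :: "('a, 'b) weyl"
    assume "weyl_mod_eq a b" "weyl_mod_eq b c"
    then show "weyl_mod_eq a c"
      using left_ideal.add [of "a - b" "range weyl_d" "b - c"] by (simp add: weyl_mod_eq_def)
  qed
qed

quotient_type (overloaded) ('n, 'k) weyl_mod_d = "('n, 'k::field) weyl" / weyl_mod_eq
  by (rule equivp_weyl_mod_eq)

instantiation weyl_mod_d :: (type, field) ab_group_add
begin

lift_definition zero_weyl_mod_d :: "('a, 'b) weyl_mod_d" is 0 .

lift_definition plus_weyl_mod_d ::
  "('a, 'b) weyl_mod_d \<Rightarrow> ('a, 'b) weyl_mod_d \<Rightarrow> ('a, 'b) weyl_mod_d" is "(+)"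
  unfolding weyl_mod_eq_def by (subst diff_add_rearrange) (rule left_ideal.add)

lift_definition minus_weyl_mod_d ::
  "('a, 'b) weyl_mod_d \<Rightarrow> ('a, 'b) weyl_mod_d \<Rightarrow> ('a, 'b) weyl_mod_d" is "(-)"
  unfolding weyl_mod_eq_def by (subst diff_diff_rearrange) (rule left_ideal_diff)

lift_definition uminus_weyl_mod_d :: "('a, 'b) weyl_mod_d \<Rightarrow> ('a, 'b) weyl_mod_d" is uminus
  unfolding weyl_mod_eq_def using left_ideal_uminus by fastforce

instance
  by standard (transfer; simp add: algebra_simps weyl_mod_eq_def left_ideal.zero)+

end

definition weyl_class :: "('n, 'k::field) weyl \<Rightarrow> ('n, 'k) weyl_mod_d" where
  "weyl_class a = abs_weyl_mod_d a"

definition weyl_smult :: "('n, 'k::field) weyl \<Rightarrow> ('n, 'k) weyl_mod_d \<Rightarrow> ('n, 'k) weyl_mod_d"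
    (infixr \<open>\<odot>\<close> 75) where
  "a \<odot> m = weyl_class (a * rep_weyl_mod_d m)"

lemma weyl_class_eq_iff: "weyl_class a = weyl_class b \<longleftrightarrow> a - b \<in> left_ideal (range weyl_d)"
  by (simp add: weyl_class_def weyl_mod_d.abs_eq_iff weyl_mod_eq_def)

lemma weyl_class_surj: "\<exists>a. m = weyl_class a"
  by (rule exI[of _ "rep_weyl_mod_d m"]) (simp add: weyl_class_def Quotient_abs_rep [OF Quotient_weyl_mod_d])

lemma weyl_class_0: "weyl_class 0 = 0"
  by (simp add: weyl_class_def zero_weyl_mod_d_def)

lemma weyl_class_add: "weyl_class (a + b) = weyl_class a + weyl_class b"
  by (simp add: weyl_class_def plus_weyl_mod_d.abs_eq)

text \<open>The scalar multiplication does not depend on the chosen representative.\<close>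

lemma weyl_smult_class: "a \<odot> weyl_class b = weyl_class (a * b)"
proof -
  have "weyl_class (rep_weyl_mod_d (weyl_class b)) = weyl_class b"
    unfolding weyl_class_def by (rule Quotient_abs_rep [OF Quotient_weyl_mod_d])
  then have "rep_weyl_mod_d (weyl_class b) - b \<in> left_ideal (range weyl_d)"
    by (simp add: weyl_class_eq_iff)
  then have "a * rep_weyl_mod_d (weyl_class b) - a * b \<in> left_ideal (range weyl_d)"
    unfolding right_diff_distrib [symmetric] by (rule left_ideal_mult_left)
  then show ?thesis
    by (simp add: weyl_smult_def weyl_class_eq_iff)
qed

definition weyl_module_hom :: "(('n, 'k::field) weyl \<Rightarrow> ('n, 'k) weyl_mod_d) \<Rightarrow> bool" where
  "weyl_module_hom \<psi> \<longleftrightarrow>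
     (\<forall>a b. \<psi> (a + b) = \<psi> a + \<psi> b) \<and> (\<forall>a b. \<psi> (a * b) = a \<odot> \<psi> b)"

definition weyl_kernel :: "(('n, 'k::field) weyl \<Rightarrow> ('n, 'k) weyl_mod_d) \<Rightarrow> ('n, 'k) weyl set" where
  "weyl_kernel \<psi> = {a. \<psi> a = 0}"

lemma weyl_module_hom_iff:
  "weyl_module_hom \<psi> \<and> \<psi> 1 = weyl_class b \<longleftrightarrow> \<psi> = (\<lambda>a. weyl_class (a * b))"
proof
  assume *: "weyl_module_hom \<psi> \<and> \<psi> 1 = weyl_class b"
  show "\<psi> = (\<lambda>a. weyl_class (a * b))"
  proof
    fix a
    have "\<psi> (a * 1) = a \<odot> \<psi> 1" using * unfolding weyl_module_hom_def by blast
    then show "\<psi> a = weyl_class (a * b)" using * by (simp add: weyl_smult_class)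
  qed
next
  assume "\<psi> = (\<lambda>a. weyl_class (a * b))"
  then show "weyl_module_hom \<psi> \<and> \<psi> 1 = weyl_class b"
    by (simp add: weyl_module_hom_def weyl_class_add weyl_smult_class distrib_right mult.assoc)
qed

end

theory Submission
  imports Defs
begin

text \<open>
  Write \<open>L\<close> for the left ideal generated by the \<open>\<partial>\<^sub>i\<close>.  Normal ordering gives
  \<open>a g \<equiv> a \<bullet> g\<close> modulo \<open>L\<close> for every operator \<open>a\<close>, because this holds for the generators: for
  \<open>\<partial>\<^sub>i\<close> it is the Leibniz rule \<open>\<partial>\<^sub>i g = g \<partial>\<^sub>i + \<partial>g/\<partial>x\<^sub>i\<close>.  Since \<open>L\<close> annihilates the
  polynomial \<open>1\<close> while \<open>h \<bullet> 1 = h\<close>, no nonzero polynomial lies in \<open>L\<close>.  Hence \<open>a g \<in> L\<close> if and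
  only if \<open>a \<bullet> g = 0\<close>.
\<close>

text \<open>Every monomial arises from a constant by multiplying by one variable at a time, so a
  property need only be checked on generators.\<close>

lemma mpoly_induct [case_names const add var]:
  fixes p :: "('n, 'k::comm_ring_1) mpoly"
  assumes const: "\<And>c. P (mpoly_const c)"
    and add: "\<And>p q. P p \<Longrightarrow> P q \<Longrightarrow> P (p + q)"
    and var: "\<And>i p. P p \<Longrightarrow> P (mpoly_var i * p)"
  shows "P p"
proof (induction p rule: poly_mapping_single_induct)
  case zero
  show ?case using const [of 0] by simp
next
  case (single \<alpha> c)
  \<comment> \<open>Exponent vectors are themselves finitely supported maps, so the same induction
    applies to them; the free shift \<open>\<beta>\<close> lets the sum case chain its two
    hypotheses.\<close>
  have "P (Poly_Mapping.single \<beta> c) \<Longrightarrow> P (Poly_Mapping.single (\<alpha> + \<beta>) c)" for \<beta>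
  proof (induction \<alpha> arbitrary: \<beta> rule: poly_mapping_single_induct)
    case (add \<alpha> \<alpha>')
    then show ?case by (simp add: add.assoc)
  next
    case (single i k)
    then show ?case
    proof (induction k)
      case (Suc k)
      have "Poly_Mapping.single i (Suc k) + \<beta>
          = Poly_Mapping.single i 1 + (Poly_Mapping.single i k + \<beta>)"
        by (simp add: add.assoc [symmetric] single_add [symmetric])
      then show ?case
        using var [OF Suc.IH [OF Suc.prems], of i] by (simp add: mult_single)
    qed simp
  qed simp
  from this [of 0] const show ?case by simp
qed (rule add)

text \<open>Words are peeled from the left, so only left multiplication by generators occurs, which
  respects congruence modulo a left ideal.\<close>

lemma weyl_induct [case_names const add x d]:
  fixes a :: "('n, 'k::field) weyl"
  assumes const: "\<And>c. P (weyl_const c)"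
    and add: "\<And>a b. P a \<Longrightarrow> P b \<Longrightarrow> P (a + b)"
    and x: "\<And>i a. P a \<Longrightarrow> P (weyl_x i * a)"
    and d: "\<And>i a. P a \<Longrightarrow> P (weyl_d i * a)"
  shows "P a"
proof -
  have "P (abs_weyl p)" for p :: "('n, 'k) free_algebra"
  proof (induction p rule: poly_mapping_single_induct)
    case zero
    show ?case using const [of 0] by (simp add: zero_weyl_def)
  next
    case (add p q)
    then show ?case using assms(2) by (simp add: plus_weyl.abs_eq [symmetric])
  next
    case (single w c)
    have "P (abs_weyl (Poly_Mapping.single (Word ls) c))" for ls
    proof (induction ls)
      case Nil
      show ?case using const [of c] by (simp add: weyl_const.abs_eq zero_word_def)
    next
      case (Cons l ls)
      show ?case
      proof (cases l)
        case (Gen_X i)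
        show ?thesis
          using x [OF Cons.IH, of i]
          by (simp add: Gen_X weyl_x_def times_weyl.abs_eq mult_single plus_word_def)
      next
        case (Gen_D i)
        show ?thesis
          using d [OF Cons.IH, of i]
          by (simp add: Gen_D weyl_d_def times_weyl.abs_eq mult_single plus_word_def)
      qed
    qed
    from this [of "letters w"] show ?case by simp
  qed
  then show ?thesis by (metis Quotient_abs_rep [OF Quotient_weyl])
qed

lemma weyl_act_0_right [simp]: "a \<bullet> 0 = 0"
  using weyl_act_add_right [of a 0 0] by simp

lemma weyl_act_0_left [simp]: "0 \<bullet> h = 0"
  using weyl_act_add_left [of 0 0 h] by simp

lemma pderivative_const [simp]: "pderivative i (mpoly_const c) = 0"
  by (simp add: pderivative_single)

lemma pderivative_one [simp]: "pderivative i 1 = 0"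
  using pderivative_const [of i 1] by simp

text \<open>Acting on 1 is a left inverse of \<open>weyl_of_poly\<close>; it recovers a polynomial
  from its operator without a normal form basis.\<close>

lemma weyl_of_poly_act_one: "weyl_of_poly h \<bullet> 1 = h"
proof (induction h rule: mpoly_induct)
  case (const c)
  show ?case by (simp add: weyl_of_poly_const weyl_act_const)
next
  case (add p q)
  then show ?case by (simp add: weyl_of_poly_add weyl_act_add_left)
next
  case (var i p)
  then show ?case
    by (simp only: weyl_of_poly_mult weyl_of_poly_var weyl_act_mult weyl_act_x)
qed

text \<open>Each summand \<open>a * s\<close> first applies the derivative \<open>s\<close> to the
  constant 1.\<close>

lemma left_ideal_d_act_one: "a \<in> left_ideal (range weyl_d) \<Longrightarrow> a \<bullet> 1 = 0"
proof (induction rule: left_ideal.induct)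
  case (generator s a)
  then show ?case by (auto simp: weyl_act_mult weyl_act_d)
qed (simp_all add: weyl_act_add_left)

lemma weyl_of_poly_in_left_ideal_iff:
  "weyl_of_poly h \<in> left_ideal (range weyl_d) \<longleftrightarrow> h = 0"
  using left_ideal_d_act_one [of "weyl_of_poly h"]
  by (auto simp: weyl_of_poly_act_one intro: left_ideal.zero)

text \<open>Moving \<open>weyl_d i\<close> past one variable at a time leaves an extra term only at
  \<open>weyl_x i\<close>, matching the product rule.\<close>

lemma weyl_d_of_poly:
  "weyl_d i * weyl_of_poly g = weyl_of_poly g * weyl_d i + weyl_of_poly (pderivative i g)"
proof (induction g rule: mpoly_induct)
  case (const c)
  show ?case by (simp add: weyl_of_poly_const weyl_const_commute)
next
  case (add p q)
  then show ?case
    by (simp add: weyl_of_poly_add pderivative_add distrib_left distrib_right ac_simps)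
next
  case (var j p)
  show ?case
  proof (cases "i = j")
    case True
    have "weyl_d i * (weyl_x i * weyl_of_poly p)
        = weyl_x i * (weyl_d i * weyl_of_poly p) + weyl_of_poly p"
      by (simp add: mult.assoc [symmetric] weyl_d_x_same distrib_right)
    with True show ?thesis
      by (simp only: var [unfolded True] pderivative_var_mult_same weyl_of_poly_mult weyl_of_poly_var
          weyl_of_poly_add distrib_left mult.assoc add.assoc)
  next
    case False
    then have "weyl_d i * (weyl_x j * weyl_of_poly p) = weyl_x j * (weyl_d i * weyl_of_poly p)"
      by (simp add: mult.assoc [symmetric] weyl_d_x_other)
    with False show ?thesis
      by (simp only: var pderivative_var_mult_other weyl_of_poly_mult weyl_of_poly_var
          distrib_left mult.assoc not_False_eq_True)
  qed
qed

lemma weyl_mult_of_poly_mod_d: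
  "weyl_class (a * weyl_of_poly g) = weyl_class (weyl_of_poly (a \<bullet> g))"
proof (induction a rule: weyl_induct)
  case (const c)
  show ?case by (simp add: weyl_act_const weyl_of_poly_mult weyl_of_poly_const)
next
  case (add a b)
  then show ?case
    by (simp add: distrib_right weyl_class_add weyl_act_add_left weyl_of_poly_add)
next
  case (x i a)
  have "weyl_class (weyl_x i * a * weyl_of_poly g)
      = weyl_class (weyl_x i * weyl_of_poly (a \<bullet> g))"
    \<comment> \<open>The class of a product depends only on the class of its right factor.\<close>
    by (metis mult.assoc weyl_smult_class x)
  then show ?case
    by (simp only: weyl_act_mult weyl_act_x weyl_of_poly_mult weyl_of_poly_var)
next
  case (d i a)
  have "weyl_class (weyl_d i * a * weyl_of_poly g)
      = weyl_class (weyl_d i * weyl_of_poly (a \<bullet> g))"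
    by (metis mult.assoc weyl_smult_class d)
  \<comment> \<open>The difference is \<open>weyl_of_poly (a \<bullet> g) * weyl_d i\<close>, a left
    multiple of a generator.\<close>
  also have "\<dots> = weyl_class (weyl_of_poly (pderivative i (a \<bullet> g)))"
    by (simp add: weyl_class_eq_iff weyl_d_of_poly left_ideal.generator)
  finally show ?case
    by (simp only: weyl_act_mult weyl_act_d)
qed

theorem lemma4p2:
  fixes g :: "('n::finite, 'k::field_char_0) mpoly"
    and \<psi> :: "('n, 'k) weyl \<Rightarrow> ('n, 'k) weyl_mod_d"
  assumes "weyl_module_hom \<psi>"
    and "\<psi> 1 = weyl_class (weyl_of_poly g)"
  shows "(\<forall>a. \<psi> a = weyl_class (a * weyl_of_poly g)) \<and> weyl_Ann g = weyl_kernel \<psi>"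
proof -
  have \<psi>: "\<psi> = (\<lambda>a. weyl_class (a * weyl_of_poly g))"
    using assms weyl_module_hom_iff by blast
  have "\<psi> a = 0 \<longleftrightarrow> a \<bullet> g = 0" for a
  proof -
    \<comment> \<open>Writing zero as \<open>weyl_class 0\<close> turns vanishing into membership in
      the left ideal.\<close>
    have "\<psi> a = 0 \<longleftrightarrow> weyl_class (weyl_of_poly (a \<bullet> g)) = weyl_class 0"
      by (simp add: \<psi> weyl_mult_of_poly_mod_d weyl_class_0)
    then show ?thesis
      by (simp add: weyl_class_eq_iff weyl_of_poly_in_left_ideal_iff)
  qed
  with \<psi> show ?thesis
    by (auto simp: weyl_Ann_def weyl_kernel_def)
qed

end
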